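(* Let $I=(G=(V,E,w,d),\beta)$ be an instance of the (optimization version of the) Directed Network Design Problem with $G$ strongly connected, $w(e)=1$ for all $e\in E$ and $\beta\ge 2(|V|-1)$. Let $v\in\operatorname{arg\,min}\{R_w^++R_w^-\mid w\in V\}$ and $E_v:=A_v^+\cup A_v^-$. Then $E_v$ is a $2$-approximation for $I$; that is, $w(E_v)\le\beta$ and $R((V,E_v))\le 2\cdot\min\{R((V,E'))\mid E'\subseteq E,\ w(E')\le\beta\}$.
   Context: $G=(V,E,w,d)$ is a finite directed graph with $w,d:E\to\mathbb{Z}_{\ge 0}$. For nodes $u,w$, $\mathrm{dist}(u,w)$ is the length with respect to $d$ of a shortest directed path from $u$ to $w$ ($\infty$ if none exists). For $E'\subseteq E$, $w(E')=\sum_{e\in E'}w(e)$ and $R((V,E'))=\sum_{u,w\in V}\mathrm{dist}|_{(V,E')}(u,w)$, with distances computed in $(V,E')$. The optimization problem asks, given $G$ and $\beta$, for $E'\subseteq E$ with $w(E')\le\beta$ and $R((V,E'))$ minimal. For a node $w\in V$, $R_w^+=\sum_{u\in V}\mathrm{dist}(w,u)$ and $R_w^-=\sum_{u\in V}\mathrm{dist}(u,w)$ (distances in $G$). An arborescence is a set $A\subseteq E$ that contains no undirected cycle, is weakly connected, and such that every vertex has at most one entering arc in $A$; an anti-arborescence is defined in the same way with "exiting" in place of "entering". $A_v^+$ is an arborescence rooted at $v$ spanning $V$ such that for every $w\in V$ the unique directed path from $v$ to $w$ in $A_v^+$ is a shortest path in $G$. $A_v^-$ is an anti-arborescence spanning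 $V$ such that for every $w\in V$ the unique directed path from $w$ to $v$ in $A_v^-$ is a shortest path in $G$. *)

theory Defs
  imports "Graph_Theory.Graph_Theory"
begin

definition graph_dist :: "('a, 'b) pre_digraph \<Rightarrow> ('b \<Rightarrow> nat) \<Rightarrow> 'a \<Rightarrow> 'a \<Rightarrow> ereal" where
  "graph_dist G d x y = wf_digraph.\<mu> G (\<lambda>e. real (d e)) x y"

definition routing_cost :: "('a, 'b) pre_digraph \<Rightarrow> ('b \<Rightarrow> nat) \<Rightarrow> ereal" where
  "routing_cost G d = (\<Sum>x\<in>verts G. \<Sum>y\<in>verts G. graph_dist G d x y)"

definition R_plus :: "('a, 'b) pre_digraph \<Rightarrow> ('b \<Rightarrow> nat) \<Rightarrow> 'a \<Rightarrow> ereal" where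
  "R_plus G d x = (\<Sum>y\<in>verts G. graph_dist G d x y)"

definition R_minus :: "('a, 'b) pre_digraph \<Rightarrow> ('b \<Rightarrow> nat) \<Rightarrow> 'a \<Rightarrow> ereal" where
  "R_minus G d x = (\<Sum>y\<in>verts G. graph_dist G d y x)"

abbreviation with_arcs :: "('a, 'b) pre_digraph \<Rightarrow> 'b set \<Rightarrow> ('a, 'b) pre_digraph" where
  "with_arcs G A \<equiv> G\<lparr>arcs := A\<rparr>"

text \<open>
  Every arc \<open>e\<close> may be traversed forwards, as \<open>(e, True)\<close>, or backwards, as \<open>(e, False)\<close>.
\<close>

definition both_ways :: "('a, 'b) pre_digraph \<Rightarrow> ('a, 'b \<times> bool) pre_digraph" where
  "both_ways G = \<lparr>verts = verts G, arcs = arcs G \<times> UNIV,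
     tail = (\<lambda>(e, fwd). if fwd then tail G e else head G e),
     head = (\<lambda>(e, fwd). if fwd then head G e else tail G e)\<rparr>"

text \<open>
  Distinctness of the underlying arcs rules out going back and forth along a single arc.
  Loops and pairs of (anti)parallel arcs are undirected cycles.
\<close>

definition undirected_cycle :: "('a, 'b) pre_digraph \<Rightarrow> ('b \<times> bool) list \<Rightarrow> bool" where
  "undirected_cycle G p \<longleftrightarrow> pre_digraph.cycle (both_ways G) p \<and> distinct (map fst p)"

text \<open>
  The (anti-)arborescences below span \<open>verts G\<close>, since weak connectedness is required of the
  graph with all vertices of \<open>G\<close>.
\<close>

definition spanning_arborescence :: "('a, 'b) pre_digraph \<Rightarrow> 'b set \<Rightarrow> bool" where
  "spanning_arborescence G A \<longleftrightarrow>
     A \<subseteq> arcs G \<and>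
     (\<nexists>p. undirected_cycle (with_arcs G A) p) \<and>
     Digraph_Component.connected (with_arcs G A) \<and>
     (\<forall>x\<in>verts G. in_degree (with_arcs G A) x \<le> 1)"

definition spanning_anti_arborescence :: "('a, 'b) pre_digraph \<Rightarrow> 'b set \<Rightarrow> bool" where
  "spanning_anti_arborescence G A \<longleftrightarrow>
     A \<subseteq> arcs G \<and>
     (\<nexists>p. undirected_cycle (with_arcs G A) p) \<and>
     Digraph_Component.connected (with_arcs G A) \<and>
     (\<forall>x\<in>verts G. out_degree (with_arcs G A) x \<le> 1)"

definition shortest_apath :: "('a, 'b) pre_digraph \<Rightarrow> ('b \<Rightarrow> nat) \<Rightarrow> 'a \<Rightarrow> 'b list \<Rightarrow> 'a \<Rightarrow> bool" where
  "shortest_apath G d x p y \<longleftrightarrow>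
     pre_digraph.apath G x p y \<and>
     ereal (real (\<Sum>e\<leftarrow>p. d e)) = graph_dist G d x y"

text \<open>
  The existence of a path from \<open>v\<close> to every vertex makes \<open>v\<close> the root of the arborescence.
\<close>

definition shortest_path_arborescence ::
    "('a, 'b) pre_digraph \<Rightarrow> ('b \<Rightarrow> nat) \<Rightarrow> 'a \<Rightarrow> 'b set \<Rightarrow> bool" where
  "shortest_path_arborescence G d v A \<longleftrightarrow>
     spanning_arborescence G A \<and>
     (\<forall>x\<in>verts G. (\<exists>!p. pre_digraph.apath (with_arcs G A) v p x) \<and>
        (\<forall>p. pre_digraph.apath (with_arcs G A) v p x \<longrightarrow> shortest_apath G d v p x))"

definition shortest_path_anti_arborescence ::
    "('a, 'b) pre_digraph \<Rightarrow> ('b \<Rightarrow> nat) \<Rightarrow> 'a \<Rightarrow> 'b set \<Rightarrow> bool" where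
  "shortest_path_anti_arborescence G d v A \<longleftrightarrow>
     spanning_anti_arborescence G A \<and>
     (\<forall>x\<in>verts G. (\<exists>!p. pre_digraph.apath (with_arcs G A) x p v) \<and>
        (\<forall>p. pre_digraph.apath (with_arcs G A) x p v \<longrightarrow> shortest_apath G d x p v))"

end

theory Submission
  imports Defs
begin

text \<open>
  The arc set of an arborescence injects into the vertices other than the root via
  \<^const>\<open>head\<close>, and dually for anti-arborescences; hence \<open>E\<^sub>v\<close> has at most \<open>2(|V| - 1)\<close> arcs.
  Routing everything through \<open>v\<close> shows that the cost of \<open>E\<^sub>v\<close> is at most
  \<open>|V| (R\<^sub>v\<^sup>+ + R\<^sub>v\<^sup>-)\<close>. As \<open>v\<close> is a minimizer, this is at most the sum of
  \<open>R\<^sub>x\<^sup>+ + R\<^sub>x\<^sup>-\<close> over all \<open>x\<close>, which is twice the cost of \<open>G\<close> itself, and no subset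
  of the arcs has smaller cost than \<open>G\<close>.
\<close>

section \<open>Walks and distances under restriction of the arc set\<close>

lemma (in wf_digraph) awalk_cost_real_eq_sum_list: "awalk_cost (\<lambda>e. real (d e)) p = real (\<Sum>e\<leftarrow>p. d e)"
  by (induction p) auto

lemma wf_digraph_with_arcs:
  assumes "wf_digraph G" "A \<subseteq> arcs G"
  shows "wf_digraph (with_arcs G A)"
  using assms by (auto simp: wf_digraph_def)

text \<open>\<open>cas\<close> consults only \<open>tail\<close> and \<open>head\<close>, which a
  change of the arc set leaves alone. Walks of different subgraphs therefore differ only in which
  arcs they may use.\<close>

lemma cas_with_arcs [simp]: "pre_digraph.cas (with_arcs G A) u p v = pre_digraph.cas G u p v"
  by (induction p arbitrary: u) (auto simp: pre_digraph.cas.simps)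

lemma awalk_with_arcs_mono:
  assumes "pre_digraph.awalk (with_arcs G A) u p v" "A \<subseteq> B"
  shows "pre_digraph.awalk (with_arcs G B) u p v"
  using assms by (auto simp: pre_digraph.awalk_def)

lemma graph_dist_eq_INF:
  assumes "wf_digraph G"
  shows "graph_dist G d x y =
    (INF p\<in>{p. pre_digraph.awalk G x p y}. ereal (real (\<Sum>e\<leftarrow>p. d e)))"
  unfolding graph_dist_def wf_digraph.\<mu>_def[OF assms]
    wf_digraph.awalk_cost_real_eq_sum_list[OF assms] ..

lemma graph_dist_le_awalk:
  assumes "wf_digraph G" "pre_digraph.awalk G x p y"
  shows "graph_dist G d x y \<le> ereal (real (\<Sum>e\<leftarrow>p. d e))"
  unfolding graph_dist_eq_INF[OF assms(1)] using assms(2) by (auto intro: INF_lower)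

text \<open>Deleting arcs leaves fewer walks, so the infimum ranges over a smaller set; it is
  infinite once no walk remains.\<close>

lemma graph_dist_with_arcs_antimono:
  assumes "wf_digraph G" "A \<subseteq> arcs G"
  shows "graph_dist G d x y \<le> graph_dist (with_arcs G A) d x y"
proof -
  have "pre_digraph.awalk G x p y" if "pre_digraph.awalk (with_arcs G A) x p y" for p
    using awalk_with_arcs_mono[OF that assms(2)] by simp
  then show ?thesis
    unfolding graph_dist_eq_INF[OF assms(1)] graph_dist_eq_INF[OF wf_digraph_with_arcs[OF assms]]
    by (intro INF_superset_mono) auto
qed

lemma routing_cost_with_arcs_antimono:
  assumes "wf_digraph G" "A \<subseteq> arcs G"
  shows "routing_cost G d \<le> routing_cost (with_arcs G A) d"
  unfolding routing_cost_def
  by (auto intro!: sum_mono graph_dist_with_arcs_antimono assms)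

text \<open>The distance of each ordered pair is counted twice, once at its source and once at its
  target.\<close>

lemma sum_R_plus_R_minus: "(\<Sum>x\<in>verts G. R_plus G d x + R_minus G d x) = 2 * routing_cost G d"
proof -
  have "(\<Sum>x\<in>verts G. R_minus G d x) = routing_cost G d"
    unfolding R_minus_def routing_cost_def by (rule sum.swap)
  then show ?thesis
    using mult_2_ereal[of "routing_cost G d"]
    by (simp add: sum.distrib R_plus_def routing_cost_def)
qed

section \<open>Directed cycles as undirected cycles\<close>

lemma cas_both_ways [simp]:
  "pre_digraph.cas (both_ways G) u (map (\<lambda>e. (e, True)) p) v = pre_digraph.cas G u p v"
  by (induction p arbitrary: u) (auto simp: pre_digraph.cas.simps both_ways_def)

lemma awalk_both_ways [simp]:
  "pre_digraph.awalk (both_ways G) u (map (\<lambda>e. (e, True)) p) v = pre_digraph.awalk G u p v"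
  by (auto simp: pre_digraph.awalk_def) (auto simp: both_ways_def)

lemma awalk_verts_both_ways [simp]:
  "pre_digraph.awalk_verts (both_ways G) u (map (\<lambda>e. (e, True)) p) = pre_digraph.awalk_verts G u p"
  by (induction p arbitrary: u) (auto simp: pre_digraph.awalk_verts.simps both_ways_def)

text \<open>Every arc is traversed forwards. The definition of \<open>cycle\<close> speaks of
  distinct vertices only; the distinct arcs come from \<open>cycle_conv\<close>.\<close>

lemma undirected_cycle_if_cycle:
  assumes "wf_digraph G" "pre_digraph.cycle G p"
  shows "undirected_cycle G (map (\<lambda>e. (e, True)) p)"
proof -
  obtain u where "pre_digraph.awalk G u p u" "distinct (tl (pre_digraph.awalk_verts G u p))"
    "distinct p" "p \<noteq> []"
    using assms wf_digraph.cycle_conv by blast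
  then show ?thesis
    unfolding undirected_cycle_def pre_digraph.cycle_def
    by (auto simp: comp_def intro!: exI[of _ u])
qed

text \<open>A nonempty closed walk contains a directed cycle, hence yields an undirected
  one.\<close>

lemma no_closed_walk_if_no_undirected_cycle:
  assumes "wf_digraph G" "\<nexists>p. undirected_cycle G p" "pre_digraph.awalk G u p u"
  shows "p = []"
proof (rule ccontr)
  assume "p \<noteq> []"
  then have "wf_digraph.closed_w G p"
    using assms(3)
    by (auto simp: wf_digraph.closed_w_def[OF assms(1)])
  then show False
    using wf_digraph.closed_w_imp_cycle undirected_cycle_if_cycle assms(1,2) by blast
qed

section \<open>Arc counts of arborescences and anti-arborescences\<close>

lemma card_spanning_arborescence_le:
  assumes "fin_digraph G" "spanning_arborescence G A" "v \<in> verts G"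
    and path: "\<And>x. x \<in> verts G \<Longrightarrow> \<exists>p. pre_digraph.awalk (with_arcs G A) v p x"
  shows "card A \<le> card (verts G) - 1"
proof -
  interpret fin_digraph G by fact
  let ?H = "with_arcs G A"
  have A: "A \<subseteq> arcs G" "\<nexists>p. undirected_cycle ?H p"
    and deg: "\<And>x. x \<in> verts G \<Longrightarrow> in_degree ?H x \<le> 1"
    using assms(2) by (auto simp: spanning_arborescence_def)
  interpret H: wf_digraph ?H
    by (rule wf_digraph_with_arcs[OF wf_digraph_axioms A(1)])
  have "finite A" by (rule finite_subset[OF A(1) finite_arcs])
  \<comment> \<open>An arc entering \<open>v\<close> would close the walk from \<open>v\<close> to
    its tail.\<close>
  have "head G e \<noteq> v" if e: "e \<in> A" for e
  proof
    assume "head G e = v"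
    obtain p where "H.awalk v p (tail G e)"
      using path e A(1) by (meson head_in_verts tail_in_verts subsetD)
    moreover have "H.awalk (tail G e) [e] v"
      using H.arc_implies_awalk[of e] e \<open>head G e = v\<close> by simp
    ultimately have "H.awalk v (p @ [e]) v"
      by (rule H.awalk_appendI)
    then show False
      using no_closed_walk_if_no_undirected_cycle[OF H.wf_digraph_axioms A(2)] by blast
  qed
  then have "head G ` A \<subseteq> verts G - {v}"
    using A(1) by auto
  moreover have "inj_on (head G) A"
  proof (rule inj_onI)
    fix e e' assume e: "e \<in> A" "e' \<in> A" "head G e = head G e'"
    \<comment> \<open>An infinite set has \<open>card\<close> 0, so the degree bound forces a single
      entering arc only together with finiteness.\<close>
    have "finite (in_arcs ?H (head G e))" "card (in_arcs ?H (head G e)) \<le> Suc 0"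
      using \<open>finite A\<close> deg[of "head G e"] e(1) A(1) by (auto simp: in_arcs_def in_degree_def)
    then show "e = e'"
      using e by (auto simp: card_le_Suc0_iff_eq)
  qed
  ultimately have "card A \<le> card (verts G - {v})"
    by (intro card_inj_on_le) auto
  then show ?thesis using assms(3) by simp
qed

text \<open>Mirror image of the previous count: an arc leaving \<open>v\<close> would be closed by
  the walk from its head back to \<open>v\<close>, and exit degrees make \<open>tail G\<close>
  injective.\<close>

lemma card_spanning_anti_arborescence_le:
  assumes "fin_digraph G" "spanning_anti_arborescence G A" "v \<in> verts G"
    and path: "\<And>x. x \<in> verts G \<Longrightarrow> \<exists>p. pre_digraph.awalk (with_arcs G A) x p v"
  shows "card A \<le> card (verts G) - 1"
proof -
  interpret fin_digraph G by fact
  let ?H = "with_arcs G A"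
  have A: "A \<subseteq> arcs G" "\<nexists>p. undirected_cycle ?H p"
    and deg: "\<And>x. x \<in> verts G \<Longrightarrow> out_degree ?H x \<le> 1"
    using assms(2) by (auto simp: spanning_anti_arborescence_def)
  interpret H: wf_digraph ?H
    by (rule wf_digraph_with_arcs[OF wf_digraph_axioms A(1)])
  have "finite A" by (rule finite_subset[OF A(1) finite_arcs])
  have "tail G e \<noteq> v" if e: "e \<in> A" for e
  proof
    assume "tail G e = v"
    obtain p where "H.awalk (head G e) p v"
      using path e A(1) by (meson head_in_verts tail_in_verts subsetD)
    moreover have "H.awalk v [e] (head G e)"
      using H.arc_implies_awalk[of e] e \<open>tail G e = v\<close> by simp
    ultimately have "H.awalk v ([e] @ p) v"
      by (intro H.awalk_appendI)
    then show False
      using no_closed_walk_if_no_undirected_cycle[OF H.wf_digraph_axioms A(2)] by blast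
  qed
  then have "tail G ` A \<subseteq> verts G - {v}"
    using A(1) by auto
  moreover have "inj_on (tail G) A"
  proof (rule inj_onI)
    fix e e' assume e: "e \<in> A" "e' \<in> A" "tail G e = tail G e'"
    have "finite (out_arcs ?H (tail G e))" "card (out_arcs ?H (tail G e)) \<le> Suc 0"
      using \<open>finite A\<close> deg[of "tail G e"] e(1) A(1) by (auto simp: out_arcs_def out_degree_def)
    then show "e = e'"
      using e by (auto simp: card_le_Suc0_iff_eq)
  qed
  ultimately have "card A \<le> card (verts G - {v})"
    by (intro card_inj_on_le) auto
  then show ?thesis using assms(3) by simp
qed

section \<open>Routing through \<open>v\<close>\<close>

lemma shortest_path_arborescence_awalk:
  assumes "shortest_path_arborescence G d v A" "x \<in> verts G"
  obtains p where "pre_digraph.awalk (with_arcs G A) v p x"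
    "ereal (real (\<Sum>e\<leftarrow>p. d e)) = graph_dist G d v x"
  using assms unfolding shortest_path_arborescence_def shortest_apath_def
  by (metis pre_digraph.apath_def)

lemma shortest_path_anti_arborescence_awalk:
  assumes "shortest_path_anti_arborescence G d v A" "x \<in> verts G"
  obtains p where "pre_digraph.awalk (with_arcs G A) x p v"
    "ereal (real (\<Sum>e\<leftarrow>p. d e)) = graph_dist G d x v"
  using assms unfolding shortest_path_anti_arborescence_def shortest_apath_def
  by (metis pre_digraph.apath_def)

text \<open>Go from \<open>x\<close> to \<open>v\<close> inside \<open>B\<close>, then from
  \<open>v\<close> to \<open>y\<close> inside \<open>A\<close>. Both pieces are shortest in
  \<open>G\<close>. The concatenation may repeat vertices, so it is treated as a walk rather than a
  path.\<close>

lemma graph_dist_union_le: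
  assumes "wf_digraph G"
    and plus: "shortest_path_arborescence G d v A" and minus: "shortest_path_anti_arborescence G d v B"
    and "x \<in> verts G" "y \<in> verts G"
  shows "graph_dist (with_arcs G (A \<union> B)) d x y \<le> graph_dist G d x v + graph_dist G d v y"
proof -
  let ?H = "with_arcs G (A \<union> B)"
  have "A \<union> B \<subseteq> arcs G"
    using plus minus
    by (auto simp: shortest_path_arborescence_def shortest_path_anti_arborescence_def
        spanning_arborescence_def spanning_anti_arborescence_def)
  then interpret H: wf_digraph ?H
    using assms(1) wf_digraph_with_arcs by blast
  obtain p where p: "H.awalk x p v" "ereal (real (\<Sum>e\<leftarrow>p. d e)) = graph_dist G d x v"
    using shortest_path_anti_arborescence_awalk[OF minus \<open>x \<in> verts G\<close>] awalk_with_arcs_mono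
    by (metis Un_upper2)
  obtain q where q: "H.awalk v q y" "ereal (real (\<Sum>e\<leftarrow>q. d e)) = graph_dist G d v y"
    using shortest_path_arborescence_awalk[OF plus \<open>y \<in> verts G\<close>] awalk_with_arcs_mono
    by (metis Un_upper1)
  have "graph_dist ?H d x y \<le> ereal (real (\<Sum>e\<leftarrow>p @ q. d e))"
    by (rule graph_dist_le_awalk[OF H.wf_digraph_axioms H.awalk_appendI[OF p(1) q(1)]])
  also have "\<dots> = graph_dist G d x v + graph_dist G d v y"
    by (simp flip: p(2) q(2))
  finally show ?thesis .
qed

text \<open>Sums the detour bound over all pairs. The bound stays a sum of a constant over
  \<open>x\<close>, so that minimality of \<open>v\<close> can later be applied term by
  term.\<close>

lemma routing_cost_union_le:
  assumes "wf_digraph G"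
    and "shortest_path_arborescence G d v A" and "shortest_path_anti_arborescence G d v B"
  shows "routing_cost (with_arcs G (A \<union> B)) d
    \<le> (\<Sum>x\<in>verts G. R_plus G d v + R_minus G d v)"
proof -
  have "routing_cost (with_arcs G (A \<union> B)) d
      \<le> (\<Sum>x\<in>verts G. \<Sum>y\<in>verts G. graph_dist G d x v + graph_dist G d v y)"
    unfolding routing_cost_def by (auto intro!: sum_mono graph_dist_union_le assms)
  also have "\<dots> = (\<Sum>x\<in>verts G. \<Sum>y\<in>verts G. graph_dist G d x v) + (\<Sum>x\<in>verts G. R_plus G d v)"
    by (simp add: sum.distrib R_plus_def)
  \<comment> \<open>After the exchange the inner sum runs over the sources, giving one copy of
    \<open>R_minus G d v\<close> per target.\<close>
  also have "(\<Sum>x\<in>verts G. \<Sum>y\<in>verts G. graph_dist G d x v) = (\<Sum>x\<in>verts G. R_minus G d v)"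
    unfolding R_minus_def by (rule sum.swap)
  finally show ?thesis
    by (simp only: sum.distrib add.commute)
qed

theorem corollary3p6:
  fixes G :: "('a, 'b) pre_digraph"
    and w d :: "'b \<Rightarrow> nat"
    and \<beta> :: real
    and v :: 'a
    and A_plus A_minus :: "'b set"
  assumes "fin_digraph G"
    and "strongly_connected G"
    and "\<And>e. e \<in> arcs G \<Longrightarrow> w e = 1"
    and "\<beta> \<ge> 2 * (real (card (verts G)) - 1)"
    and "is_arg_min (\<lambda>x. R_plus G d x + R_minus G d x) (\<lambda>x. x \<in> verts G) v"
    and "shortest_path_arborescence G d v A_plus"
    and "shortest_path_anti_arborescence G d v A_minus"
  shows "real (\<Sum>e\<in>A_plus \<union> A_minus. w e) \<le> \<beta> \<and>
    routing_cost (with_arcs G (A_plus \<union> A_minus)) d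
      \<le> 2 * Min {routing_cost (with_arcs G E') d | E'.
                   E' \<subseteq> arcs G \<and> real (\<Sum>e\<in>E'. w e) \<le> \<beta>}"
proof -
  interpret fin_digraph G by fact
  let ?E = "A_plus \<union> A_minus"
  let ?S = "{routing_cost (with_arcs G E') d | E'. E' \<subseteq> arcs G \<and> real (\<Sum>e\<in>E'. w e) \<le> \<beta>}"
  have v: "v \<in> verts G"
    and v_min: "\<And>x. x \<in> verts G \<Longrightarrow> R_plus G d v + R_minus G d v \<le> R_plus G d x + R_minus G d x"
    using assms(5) by (auto simp: is_arg_min_linorder)
  have plus: "spanning_arborescence G A_plus" and minus: "spanning_anti_arborescence G A_minus"
    using assms(6,7)
    by (auto simp: shortest_path_arborescence_def shortest_path_anti_arborescence_def)
  then have E: "?E \<subseteq> arcs G"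
    by (auto simp: spanning_arborescence_def spanning_anti_arborescence_def)

  have "card A_plus \<le> card (verts G) - 1"
    using shortest_path_arborescence_awalk[OF assms(6)]
    by (intro card_spanning_arborescence_le[OF assms(1) plus v]) metis
  moreover have "card A_minus \<le> card (verts G) - 1"
    using shortest_path_anti_arborescence_awalk[OF assms(7)]
    by (intro card_spanning_anti_arborescence_le[OF assms(1) minus v]) metis
  \<comment> \<open>Makes the truncated subtraction in \<open>card (verts G) - 1\<close>
    exact.\<close>
  moreover have "card (verts G) > 0"
    using v by (auto simp: card_gt_0_iff)
  ultimately have "card ?E + 2 \<le> 2 * card (verts G)"
    using card_Un_le[of A_plus A_minus] by linarith
  then have "real (card ?E + 2) \<le> real (2 * card (verts G))"
    by (rule of_nat_mono)
  then have "real (card ?E) \<le> 2 * (real (card (verts G)) - 1)"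
    by simp
  moreover have "(\<Sum>e\<in>?E. w e) = card ?E"
    unfolding card_eq_sum using E assms(3) by (intro sum.cong) auto
  ultimately have weight: "real (\<Sum>e\<in>?E. w e) \<le> \<beta>"
    using assms(4) by simp

  \<comment> \<open>\<open>Min\<close> is a genuine minimum only on a finite nonempty set:
    \<open>G\<close> has finitely many arc subsets, and \<open>?E\<close> itself is within the
    budget.\<close>
  have "?S \<subseteq> (\<lambda>E'. routing_cost (with_arcs G E') d) ` Pow (arcs G)"
    by auto
  then have "finite ?S"
    by (rule finite_subset) simp
  moreover have "?S \<noteq> {}"
    using E weight by blast
  \<comment> \<open>\<open>G\<close> with all its arcs may exceed the budget; its cost serves as a
    lower bound on the optimum.\<close>
  moreover have "routing_cost G d \<le> r" if "r \<in> ?S" for r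
    using that routing_cost_with_arcs_antimono[OF wf_digraph_axioms] by auto
  ultimately have "routing_cost G d \<le> Min ?S"
    by simp

  have "routing_cost (with_arcs G ?E) d \<le> (\<Sum>x\<in>verts G. R_plus G d v + R_minus G d v)"
    by (rule routing_cost_union_le[OF wf_digraph_axioms assms(6,7)])
  also have "\<dots> \<le> (\<Sum>x\<in>verts G. R_plus G d x + R_minus G d x)"
    by (intro sum_mono v_min)
  also have "\<dots> = 2 * routing_cost G d"
    by (rule sum_R_plus_R_minus)
  also have "\<dots> \<le> 2 * Min ?S"
    using \<open>routing_cost G d \<le> Min ?S\<close> by (intro ereal_mult_left_mono) auto
  finally show ?thesis
    using weight by blast
qed

end
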